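(* Consider the irreducible representation $\pi_w$ with highest weight $w=(w_1,w_2,w_3)$, highest weight vector $\phi_w$, coherent vectors $\phi_z=[V'_+(z)]^+\phi_w$ and functions $f_\psi(z)=(\phi_z,\psi)$, $z=(z_{12},z_{13},z_{23})\in\mathbb C^3$, on the flag manifold $SU(3)/S(U(1)\times U(1)\times U(1))$, as described in the context. Then the differential operators $\mathbb C_{ij}$ associated to the generators $C_{ij}$, i.e. such that $f_{\mathbf C_{ij}\psi}=\mathbb C_{ij}f_\psi$ for all $\psi$, are given, with $\partial_{kl}=\partial/\partial z_{kl}$, by $$\mathbb C_{11}=-z_{12}\partial_{12}-z_{13}\partial_{13}+w_1,\qquad \mathbb C_{12}=\partial_{12},\qquad \mathbb C_{13}=\partial_{13},$$ $$\mathbb C_{21}=-z_{12}^2\partial_{12}-z_{12}z_{13}\partial_{13}+(z_{12}z_{23}-z_{13})\partial_{23}+(w_1-w_2)z_{12},$$ $$\mathbb C_{22}=z_{12}\partial_{12}-z_{23}\partial_{23}+w_2,\qquad \mathbb C_{23}=z_{12}\partial_{13}+\partial_{23},$$ $$\mathbb C_{31}=-z_{12}z_{13}\partial_{12}-z_{13}^2\partial_{13}+(z_{12}z_{23}-z_{13})z_{23}\partial_{23}+(w_1-w_3)z_{13}-(w_2-w_3)z_{12}z_{23},$$ $$\mathbb C_{32}=z_{13}\partial_{12}-z_{23}^2\partial_{23}+(w_2-w_3)z_{23},\qquad \mathbb C_{33}=z_{13}\partial_{13}+z_{23}\partial_{23}+w_3.$$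
   Context: The generators $C_{ij}$, $1\le i,j\le3$, satisfy $[C_{ij},C_{kl}]=\delta_{jk}C_{il}-\delta_{il}C_{kj}$ (standard basis of $\mathfrak{gl}(3,\mathbb C)$). $\pi_w$ is a finite-dimensional irreducible representation on a Hilbert space (scalar product antilinear in the first argument), unitary for the compact group, so that $\mathbf C_{ij}:=\pi_w(C_{ij})$ satisfies $\mathbf C_{ij}^+=\mathbf C_{ji}$ ($^+$ denotes the adjoint). The vector $\phi_w$ is a highest weight vector: $\mathbf C_{ij}\phi_w=0$ for $i<j$, $\mathbf C_{ii}\phi_w=w_i\phi_w$, with $w_1-w_2\ge0$, $w_2-w_3\ge0$; the lowering operators are $\mathbf C_{ij}$, $i>j$. Put $V'_+(z)=\exp(z_{23}\mathbf C_{23})\exp(z_{12}\mathbf C_{12}+z_{13}\mathbf C_{13})$. Then $\phi_z=[V'_+(z)]^+\phi_w=\exp(\bar z_{12}\mathbf C_{21}+\bar z_{13}\mathbf C_{31})\exp(\bar z_{23}\mathbf C_{32})\phi_w$ and $f_\psi(z)=(\phi_z,\psi)=(\phi_w,V'_+(z)\psi)$, a polynomial in $z$; $z$ are local coordinates on $SU(3)/S(U(1)\times U(1)\times U(1))$. *)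

theory Defs
  imports "HOL-Analysis.Analysis"
begin

text \<open>Complex inner product spaces; the inner product is antilinear in its first argument.\<close>

class complex_inner = real_normed_vector +
  fixes scaleC :: "complex \<Rightarrow> 'a \<Rightarrow> 'a" (infixr "*\<^sub>C" 75)
    and cinner :: "'a \<Rightarrow> 'a \<Rightarrow> complex"
  assumes scaleC_add_right: "c *\<^sub>C (x + y) = c *\<^sub>C x + c *\<^sub>C y"
    and scaleC_add_left: "(c + d) *\<^sub>C x = c *\<^sub>C x + d *\<^sub>C x"
    and scaleC_scaleC: "c *\<^sub>C (d *\<^sub>C x) = (c * d) *\<^sub>C x"
    and scaleC_one: "1 *\<^sub>C x = x"
    and scaleR_scaleC: "r *\<^sub>R x = complex_of_real r *\<^sub>C x"
    and cinner_commute: "cinner x y = cnj (cinner y x)"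
    and cinner_add_right: "cinner x (y + z) = cinner x y + cinner x z"
    and cinner_scaleC_right: "cinner x (c *\<^sub>C y) = c * cinner x y"
    and cinner_pos: "x \<noteq> 0 \<Longrightarrow> 0 < Re (cinner x x)"
    and norm_eq_sqrt_cinner: "norm x = sqrt (Re (cinner x x))"

global_interpretation complex_vector: vector_space "scaleC :: complex \<Rightarrow> 'a \<Rightarrow> 'a::complex_inner"
  by unfold_locales (rule scaleC_add_right scaleC_add_left scaleC_scaleC scaleC_one)+

lemma cinner_scaleC_left: "cinner (c *\<^sub>C x) y = cnj c * cinner x y"
  by (metis cinner_commute cinner_scaleC_right complex_cnj_mult)

lemma cinner_add_left: "cinner (x + y) z = cinner x z + cinner y z"
  by (metis cinner_commute cinner_add_right complex_cnj_add)

abbreviation clinear :: "('v::complex_inner \<Rightarrow> 'v) \<Rightarrow> bool"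
  where "clinear \<equiv> Vector_Spaces.linear scaleC scaleC"

definition is_adjoint :: "('v::complex_inner \<Rightarrow> 'v) \<Rightarrow> ('v \<Rightarrow> 'v) \<Rightarrow> bool"
  where "is_adjoint A B \<longleftrightarrow> (\<forall>x y. cinner (B x) y = cinner x (A y))"

definition cadjoint :: "('v::complex_inner \<Rightarrow> 'v) \<Rightarrow> 'v \<Rightarrow> 'v"
  where "cadjoint A = (SOME B. is_adjoint A B)"

lemma is_adjoint_unique:
  fixes A :: "'v::complex_inner \<Rightarrow> 'v"
  assumes "is_adjoint A B" "is_adjoint A B'"
  shows "B = B'"
proof
  fix x
  let ?d = "B x - B' x"
  have "cinner (B' x + ?d) ?d = cinner (B' x) ?d"
    using assms unfolding is_adjoint_def by simp
  then have "cinner ?d ?d = 0"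
    unfolding cinner_add_left by simp
  then show "B x = B' x"
    using cinner_pos[of ?d] by fastforce
qed

lemma cadjoint_eq: "is_adjoint A B \<Longrightarrow> cadjoint A = B"
  unfolding cadjoint_def by (rule some_equality) (auto dest: is_adjoint_unique)

text \<open>In finite dimension the exponential series of a linear operator converges pointwise in norm.\<close>

definition op_exp :: "('v::complex_inner \<Rightarrow> 'v) \<Rightarrow> 'v \<Rightarrow> 'v"
  where "op_exp A v = (\<Sum>n. (1 / fact n) *\<^sub>C (A ^^ n) v)"

text \<open>The Lie algebra \<open>gl(3, \<complex>)\<close> is the space of matrices under the commutator, with basis of
  matrix units. Indices are explicit elements of type \<open>3\<close>; its library order
  (in which \<open>3 = 0\<close>) is never used.\<close>

type_synonym gl3 = "complex ^ 3 ^ 3"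

definition Cgen :: "3 \<Rightarrow> 3 \<Rightarrow> gl3"
  where "Cgen i j = (\<chi> k l. if k = i \<and> l = j then 1 else 0)"

definition lie :: "gl3 \<Rightarrow> gl3 \<Rightarrow> gl3"
  where "lie X Y = X ** Y - Y ** X"

definition mscale :: "complex \<Rightarrow> gl3 \<Rightarrow> gl3"
  where "mscale c X = (\<chi> k l. c * X $ k $ l)"

definition conj_transpose :: "gl3 \<Rightarrow> gl3"
  where "conj_transpose X = (\<chi> k l. cnj (X $ l $ k))"

lemma Cgen_mult: "Cgen i j ** Cgen k l = (if j = k then Cgen i l else 0)"
  by (auto simp: Cgen_def matrix_matrix_mult_def vec_eq_iff if_distrib [of "\<lambda>x. x * _"]
      cong: if_cong)

lemma lie_Cgen:
  "lie (Cgen i j) (Cgen k l) = mscale (of_bool (j = k)) (Cgen i l) - mscale (of_bool (i = l)) (Cgen k j)"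
  by (auto simp: lie_def Cgen_mult mscale_def vec_eq_iff)

definition gl3_rep :: "(gl3 \<Rightarrow> 'v::complex_inner \<Rightarrow> 'v) \<Rightarrow> bool"
  where "gl3_rep \<pi> \<longleftrightarrow>
    (\<forall>X. clinear (\<pi> X)) \<and>
    (\<forall>X Y v. \<pi> (X + Y) v = \<pi> X v + \<pi> Y v) \<and>
    (\<forall>c X v. \<pi> (mscale c X) v = c *\<^sub>C \<pi> X v) \<and>
    (\<forall>X Y v. \<pi> (lie X Y) v = \<pi> X (\<pi> Y v) - \<pi> Y (\<pi> X v))"

text \<open>Unitarity for the compact group, on the level of its Lie algebra \<open>u(3)\<close> of skew-Hermitian
  matrices, which acts by skew-adjoint operators.\<close>

definition unitary_rep :: "(gl3 \<Rightarrow> 'v::complex_inner \<Rightarrow> 'v) \<Rightarrow> bool"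
  where "unitary_rep \<pi> \<longleftrightarrow>
    (\<forall>X. conj_transpose X = - X \<longrightarrow> is_adjoint (\<pi> X) (\<lambda>v. - \<pi> X v))"

definition irreducible_rep :: "(gl3 \<Rightarrow> 'v::complex_inner \<Rightarrow> 'v) \<Rightarrow> bool"
  where "irreducible_rep \<pi> \<longleftrightarrow> (UNIV :: 'v set) \<noteq> {0} \<and>
    (\<forall>S. complex_vector.subspace S \<and> (\<forall>X. \<forall>v\<in>S. \<pi> X v \<in> S) \<longrightarrow> S = {0} \<or> S = UNIV)"

text \<open>A type is a finite-dimensional Hilbert space if it has a finite spanning set over \<open>\<complex>\<close>;
  completeness is then automatic.\<close>

definition cfinite_dim :: "'v::complex_inner itself \<Rightarrow> bool"
  where "cfinite_dim _ \<longleftrightarrow> (\<exists>B :: 'v set. finite B \<and> complex_vector.span B = UNIV)"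

definition highest_weight_vector ::
    "(gl3 \<Rightarrow> 'v::complex_inner \<Rightarrow> 'v) \<Rightarrow> real ^ 3 \<Rightarrow> 'v \<Rightarrow> bool"
  where "highest_weight_vector \<pi> w \<phi> \<longleftrightarrow> \<phi> \<noteq> 0 \<and>
    \<pi> (Cgen 1 2) \<phi> = 0 \<and> \<pi> (Cgen 1 3) \<phi> = 0 \<and> \<pi> (Cgen 2 3) \<phi> = 0 \<and>
    (\<forall>i. \<pi> (Cgen i i) \<phi> = complex_of_real (w $ i) *\<^sub>C \<phi>)"

lemma conj_transpose_Cgen: "conj_transpose (Cgen i j) = Cgen j i"
  unfolding conj_transpose_def Cgen_def vec_eq_iff by simp

lemma conj_transpose_add: "conj_transpose (X + Y) = conj_transpose X + conj_transpose Y"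
  unfolding conj_transpose_def vec_eq_iff by simp

lemma conj_transpose_mscale: "conj_transpose (mscale c X) = mscale (cnj c) (conj_transpose X)"
  unfolding conj_transpose_def mscale_def vec_eq_iff by simp

lemma mscale_minus: "mscale (- c) X = - mscale c X"
  unfolding mscale_def vec_eq_iff by simp

lemma mscale_one: "mscale 1 X = X"
  unfolding mscale_def vec_eq_iff by simp

lemma unitary_rep_Cgen:
  fixes \<pi> :: "gl3 \<Rightarrow> 'v::complex_inner \<Rightarrow> 'v"
  assumes rep: "gl3_rep \<pi>" and uni: "unitary_rep \<pi>"
  shows "is_adjoint (\<pi> (Cgen i j)) (\<pi> (Cgen j i))"
  unfolding is_adjoint_def
proof (intro allI)
  fix x y
  let ?A = "\<pi> (Cgen i j)" and ?B = "\<pi> (Cgen j i)"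
  have add: "\<pi> (X + Y) v = \<pi> X v + \<pi> Y v" and scale: "\<pi> (mscale c X) v = c *\<^sub>C \<pi> X v"
    for X Y c v
    using rep unfolding gl3_rep_def by blast+
  have skew: "cinner (\<pi> X x) y = - cinner x (\<pi> X y)" if "conj_transpose X = - X" for X
  proof -
    have "cinner (- \<pi> X x) y = cinner x (\<pi> X y)"
      using uni that unfolding unitary_rep_def is_adjoint_def by blast
    moreover have "- \<pi> X x = (-1) *\<^sub>C \<pi> X x"
      by simp
    ultimately show ?thesis
      by (metis add.inverse_inverse cinner_scaleC_left complex_cnj_minus complex_cnj_one
          mult_minus1)
  qed
  have "conj_transpose (Cgen i j + mscale (-1) (Cgen j i)) = - (Cgen i j + mscale (-1) (Cgen j i))"
    unfolding conj_transpose_add conj_transpose_mscale conj_transpose_Cgen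
    by (simp add: mscale_minus mscale_one)
  from skew[OF this]
  have "cinner (?A x) y - cinner (?B x) y = - cinner x (?A y) + cinner x (?B y)"
    unfolding add scale cinner_add_left cinner_add_right cinner_scaleC_left cinner_scaleC_right
    by (simp add: algebra_simps)
  moreover have "conj_transpose (mscale \<i> (Cgen i j) + mscale \<i> (Cgen j i))
      = - (mscale \<i> (Cgen i j) + mscale \<i> (Cgen j i))"
    unfolding conj_transpose_add conj_transpose_mscale conj_transpose_Cgen
    by (simp add: mscale_minus mscale_one)
  from skew[OF this]
  have "\<i> * (cinner (?A x) y + cinner (?B x) y) = \<i> * (cinner x (?A y) + cinner x (?B y))"
    unfolding add scale cinner_add_left cinner_add_right cinner_scaleC_left cinner_scaleC_right
    by (simp add: algebra_simps)
  then have "cinner (?A x) y + cinner (?B x) y = cinner x (?A y) + cinner x (?B y)"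
    by (metis complex_i_not_zero mult_left_cancel)
  ultimately show "cinner (?B x) y = cinner x (?A y)"
    unfolding complex_eq_iff plus_complex.sel minus_complex.sel uminus_complex.sel by linarith
qed

text \<open>Points are triples \<open>z = (z\<^sub>1\<^sub>2, z\<^sub>1\<^sub>3, z\<^sub>2\<^sub>3)\<close>.\<close>

type_synonym coords = "complex \<times> complex \<times> complex"

definition Vplus :: "(gl3 \<Rightarrow> 'v::complex_inner \<Rightarrow> 'v) \<Rightarrow> coords \<Rightarrow> 'v \<Rightarrow> 'v"
  where "Vplus \<pi> = (\<lambda>(z12, z13, z23).
    op_exp (\<lambda>v. z23 *\<^sub>C \<pi> (Cgen 2 3) v) \<circ>
    op_exp (\<lambda>v. z12 *\<^sub>C \<pi> (Cgen 1 2) v + z13 *\<^sub>C \<pi> (Cgen 1 3) v))"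

definition coherent :: "(gl3 \<Rightarrow> 'v::complex_inner \<Rightarrow> 'v) \<Rightarrow> 'v \<Rightarrow> coords \<Rightarrow> 'v"
  where "coherent \<pi> \<phi> z = cadjoint (Vplus \<pi> z) \<phi>"

definition coh_fun :: "(gl3 \<Rightarrow> 'v::complex_inner \<Rightarrow> 'v) \<Rightarrow> 'v \<Rightarrow> 'v \<Rightarrow> coords \<Rightarrow> complex"
  where "coh_fun \<pi> \<phi> \<psi> z = cinner (coherent \<pi> \<phi> z) \<psi>"

definition d12 :: "(coords \<Rightarrow> complex) \<Rightarrow> coords \<Rightarrow> complex"
  where "d12 f = (\<lambda>(z12, z13, z23). deriv (\<lambda>t. f (t, z13, z23)) z12)"

definition d13 :: "(coords \<Rightarrow> complex) \<Rightarrow> coords \<Rightarrow> complex"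
  where "d13 f = (\<lambda>(z12, z13, z23). deriv (\<lambda>t. f (z12, t, z23)) z13)"

definition d23 :: "(coords \<Rightarrow> complex) \<Rightarrow> coords \<Rightarrow> complex"
  where "d23 f = (\<lambda>(z12, z13, z23). deriv (\<lambda>t. f (z12, z13, t)) z23)"

definition associated_op ::
    "(gl3 \<Rightarrow> 'v::complex_inner \<Rightarrow> 'v) \<Rightarrow> 'v \<Rightarrow> gl3 \<Rightarrow>
     ((coords \<Rightarrow> complex) \<Rightarrow> coords \<Rightarrow> complex) \<Rightarrow> bool"
  where "associated_op \<pi> \<phi> X D \<longleftrightarrow> (\<forall>\<psi>. coh_fun \<pi> \<phi> (\<pi> X \<psi>) = D (coh_fun \<pi> \<phi> \<psi>))"

end

theory Submission
  imports Defs
begin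

text \<open>The representation space is spanned by joint eigenvectors of the \<open>C\<^sub>i\<^sub>i\<close>: their span is
  invariant and contains \<open>\<phi>\<close>. Hence \<open>z\<^sub>1\<^sub>2 C\<^sub>1\<^sub>2 + z\<^sub>1\<^sub>3 C\<^sub>1\<^sub>3\<close> and \<open>z\<^sub>2\<^sub>3 C\<^sub>2\<^sub>3\<close> act nilpotently, all exponential series are
  finite sums, and \<open>f\<^sub>\<psi>(z) = (\<phi>, e\<^sup>B e\<^sup>A \<psi>)\<close> with \<open>A = z\<^sub>1\<^sub>2 C\<^sub>1\<^sub>2 + z\<^sub>1\<^sub>3 C\<^sub>1\<^sub>3\<close>, \<open>B = z\<^sub>2\<^sub>3 C\<^sub>2\<^sub>3\<close>.
  As \<open>A\<^sup>2 = 0\<close> in matrices, \<open>e\<^sup>A X = (X + [A, X] - A X A) e\<^sup>A\<close>, and likewise for \<open>B\<close>. Moving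
  \<open>X = C\<^sub>i\<^sub>j\<close> to the left in \<open>(\<phi>, e\<^sup>B e\<^sup>A X \<psi>)\<close>, the raising generators standing between \<open>e\<^sup>B\<close> and \<open>e\<^sup>A\<close>
  produce the partial derivatives, whereas the lowering and diagonal ones are moved on to \<open>\<phi>\<close>, where
  they vanish or produce the weights.\<close>

section \<open>Complex linear maps and functionals\<close>

interpretation operator: vector_space_pair
  "scaleC :: complex \<Rightarrow> 'a::complex_inner \<Rightarrow> 'a" "scaleC :: complex \<Rightarrow> 'b::complex_inner \<Rightarrow> 'b"
  by unfold_locales

interpretation functional: vector_space_pair
  "scaleC :: complex \<Rightarrow> 'a::complex_inner \<Rightarrow> 'a" "(*) :: complex \<Rightarrow> complex \<Rightarrow> complex"
  by (intro vector_space_pair.intro complex_vector.vector_space_axioms)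
     (unfold_locales, simp_all add: algebra_simps)

abbreviation cfunctional :: "('v::complex_inner \<Rightarrow> complex) \<Rightarrow> bool"
  where "cfunctional \<equiv> Vector_Spaces.linear scaleC (*)"

lemma clinearI:
  fixes A :: "'v::complex_inner \<Rightarrow> 'v"
  assumes "\<And>u v. A (u + v) = A u + A v" and "\<And>c v. A (c *\<^sub>C v) = c *\<^sub>C A v"
  shows "clinear A"
  using assms by (simp add: Vector_Spaces.linear_iff complex_vector.vector_space_axioms)

lemma cfunctionalI:
  fixes F :: "'v::complex_inner \<Rightarrow> complex"
  assumes "\<And>u v. F (u + v) = F u + F v" and "\<And>c v. F (c *\<^sub>C v) = c * F v"
  shows "cfunctional F"
  using assms vector_space_over_itself.vector_space_axioms
  by (simp add: Vector_Spaces.linear_iff complex_vector.vector_space_axioms)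

lemma cfunctional_cinner: "cfunctional (cinner x)"
  by (intro cfunctionalI cinner_add_right cinner_scaleC_right)

lemma cfunctional_compose:
  assumes "cfunctional F" and "clinear A"
  shows "cfunctional (\<lambda>v. F (A v))"
  using Vector_Spaces.linear_compose[OF assms(2,1)] by (simp add: o_def)

lemma clinear_compose:
  assumes "clinear A" and "clinear B"
  shows "clinear (\<lambda>v. A (B v))"
  using Vector_Spaces.linear_compose[OF assms(2,1)] by (simp add: o_def)

lemma cinner_sum_left: "cinner (sum f S) y = (\<Sum>i\<in>S. cinner (f i) y)"
proof -
  have "cinner (sum f S) y = cnj (cinner y (sum f S))"
    by (rule cinner_commute)
  also have "\<dots> = (\<Sum>i\<in>S. cnj (cinner y (f i)))"
    by (simp add: functional.linear_sum[OF cfunctional_cinner])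
  finally show ?thesis
    by (simp flip: cinner_commute)
qed

lemma clinear_funpow: "clinear A \<Longrightarrow> clinear (A ^^ n)"
proof (induction n)
  case 0
  show ?case by (rule clinearI) auto
next
  case (Suc n)
  then show ?case using clinear_compose[of A "A ^^ n"] by (simp add: o_def)
qed

section \<open>Nilpotent operators and their exponentials\<close>

definition nilpotent_op :: "nat \<Rightarrow> ('v::complex_inner \<Rightarrow> 'v) \<Rightarrow> bool"
  where "nilpotent_op N A \<longleftrightarrow> clinear A \<and> (\<forall>v. (A ^^ N) v = 0)"

lemma op_exp_nilpotent:
  assumes "nilpotent_op N A" and "N \<le> M"
  shows "op_exp A v = (\<Sum>n<M. (1 / fact n) *\<^sub>C (A ^^ n) v)"
proof -
  have "(A ^^ n) v = 0" if "n \<ge> M" for n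
  proof -
    have "(A ^^ n) v = (A ^^ N) ((A ^^ (n - N)) v)"
      using that assms(2) by (simp flip: funpow_add comp_apply[of "A ^^ N"])
    then show ?thesis
      using assms(1) by (simp add: nilpotent_op_def)
  qed
  then show ?thesis
    unfolding op_exp_def by (intro suminf_finite) auto
qed

lemma clinear_op_exp:
  assumes "nilpotent_op N A"
  shows "clinear (op_exp A)"
proof (rule clinearI)
  have lin: "clinear (A ^^ n)" for n
    using assms by (simp add: nilpotent_op_def clinear_funpow)
  note e = op_exp_nilpotent[OF assms order_refl]
  show "op_exp A (u + v) = op_exp A u + op_exp A v" for u v
    by (simp add: e operator.linear_add[OF lin] scaleC_add_right sum.distrib)
  show "op_exp A (c *\<^sub>C v) = c *\<^sub>C op_exp A v" for c v
    by (simp add: e operator.linear_scale[OF lin] complex_vector.scale_sum_right mult.commute)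
qed

text \<open>Adjoints pass through powers and finite sums, and the coefficients 1/n! are
  real.\<close>

lemma is_adjoint_op_exp:
  assumes "nilpotent_op N A" and "nilpotent_op N B" and "is_adjoint A B"
  shows "is_adjoint (op_exp A) (op_exp B)"
proof -
  have "cinner ((B ^^ n) x) y = cinner x ((A ^^ n) y)" for n x y
    using assms(3) by (induction n arbitrary: x y) (simp_all add: is_adjoint_def funpow_swap1)
  moreover have "cnj (1 / fact n) = 1 / fact n" for n
    by (metis complex_cnj_divide complex_cnj_of_nat complex_cnj_one of_nat_fact)
  ultimately show ?thesis
    by (simp add: is_adjoint_def op_exp_nilpotent[OF assms(1) order_refl]
        op_exp_nilpotent[OF assms(2) order_refl] cinner_sum_left cinner_scaleC_left
        functional.linear_sum[OF cfunctional_cinner] cinner_scaleC_right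
        del: complex_cnj_divide)
qed

text \<open>Here Y = [A, X], 2 Z = [A, Y] and [A, Z] = 0, so the expansion of e^A X e^(-A) in
  iterated commutators stops at second order, and the 2 cancels 1/2!. The series are compared term
  by term, without an inverse exponential.\<close>

lemma op_exp_intertwine:
  assumes A: "nilpotent_op N A" and X: "clinear X" and Y: "clinear Y" and Z: "clinear Z"
    and AX: "\<And>v. A (X v) = X (A v) + Y v"
    and AY: "\<And>v. A (Y v) = Y (A v) + 2 *\<^sub>C Z v"
    and AZ: "\<And>v. A (Z v) = Z (A v)"
  shows "op_exp A (X v) = X (op_exp A v) + Y (op_exp A v) + Z (op_exp A v)"
proof -
  define a where "a n u = (1 / fact n) *\<^sub>C (A ^^ n) u" for n u
  have lin: "clinear A"
    using A by (simp add: nilpotent_op_def)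
  \<comment> \<open>Moving X past m = n + 2 factors A gives X, m copies of Y and m (m - 1) / 2
    copies of 2 Z. Starting at m = 2 avoids truncated subtraction; m = 0 and m = 1 are treated
    separately.\<close>
  have "(A ^^ (n + 2)) (X v) = X ((A ^^ (n + 2)) v) + of_nat (n + 2) *\<^sub>C Y ((A ^^ (n + 1)) v)
      + of_nat ((n + 2) * (n + 1)) *\<^sub>C Z ((A ^^ n) v)" for n
  proof (induction n)
    case 0
    show ?case
      by (simp add: numeral_2_eq_2 AX AY operator.linear_add[OF lin])
         (simp flip: complex_vector.scale_left_distrib[of 1 1, simplified])
  next
    case (Suc n)
    have "(A ^^ (Suc n + 2)) (X v) = X ((A ^^ (n + 3)) v)
        + (Y ((A ^^ (n + 2)) v) + of_nat (n + 2) *\<^sub>C Y ((A ^^ (n + 2)) v))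
        + ((of_nat (n + 2) * 2) *\<^sub>C Z ((A ^^ (n + 1)) v)
           + of_nat ((n + 2) * (n + 1)) *\<^sub>C Z ((A ^^ (n + 1)) v))"
      using arg_cong[OF Suc.IH, of A]
      by (simp add: AX AY AZ operator.linear_add[OF lin] operator.linear_scale[OF lin]
          scaleC_add_right eval_nat_numeral del: of_nat_Suc of_nat_add of_nat_mult)
    also have "Y ((A ^^ (n + 2)) v) + of_nat (n + 2) *\<^sub>C Y ((A ^^ (n + 2)) v)
        = of_nat (Suc n + 2) *\<^sub>C Y ((A ^^ (n + 2)) v)"
      using scaleC_add_left[of 1 "of_nat (n + 2)" "Y ((A ^^ (n + 2)) v)"]
      by (simp add: add.commute add.left_commute)
    also have "(of_nat (n + 2) * 2) *\<^sub>C Z ((A ^^ (n + 1)) v)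
        + of_nat ((n + 2) * (n + 1)) *\<^sub>C Z ((A ^^ (n + 1)) v)
        = of_nat ((Suc n + 2) * (Suc n + 1)) *\<^sub>C Z ((A ^^ (n + 1)) v)"
      unfolding scaleC_add_left[symmetric] by (simp add: algebra_simps)
    finally show ?case
      by (simp add: eval_nat_numeral)
  qed
  then have a2: "a (Suc (Suc n)) (X v) = X (a (Suc (Suc n)) v) + Y (a (Suc n) v) + Z (a n v)" for n
    unfolding a_def operator.linear_scale[OF X] operator.linear_scale[OF Y] operator.linear_scale[OF Z]
    by (simp add: scaleC_add_right field_simps of_nat_mult del: funpow.simps of_nat_Suc mult_Suc mult_Suc_right)
  have a1: "a (Suc 0) (X v) = X (a (Suc 0) v) + Y (a 0 v)"
    and a0: "a 0 (X v) = X (a 0 v)"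
    by (simp_all add: a_def AX)
  have e: "op_exp A u = (\<Sum>n<M. a n u)" if "M \<ge> N" for M u
    unfolding a_def by (rule op_exp_nilpotent[OF A that])
  \<comment> \<open>The Y terms are shifted by one index and the Z terms by two, hence the three
    lengths; all are at least \<open>N\<close>, so each sum is the full exponential.\<close>
  have "op_exp A (X v) = X (\<Sum>n<Suc (Suc N). a n v) + Y (\<Sum>n<Suc N. a n v) + Z (\<Sum>n<N. a n v)"
    using e[of "Suc (Suc N)" "X v"]
    unfolding operator.linear_sum[OF X] operator.linear_sum[OF Y] operator.linear_sum[OF Z]
    by (simp add: sum.lessThan_Suc_shift a0 a1 a2 sum.distrib del: sum.lessThan_Suc)
  then show ?thesis
    using e[of "Suc (Suc N)" v] e[of "Suc N" v] e[of N v] by simp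
qed

text \<open>Because X commutes with Y, differentiating (t X + Y)^n gives n (t X + Y)^(n - 1) X. The
  exponent \<open>N\<close> common to all t makes the exponential a finite sum of fixed length, and
  F makes it complex valued.\<close>

lemma has_field_derivative_op_exp:
  assumes F: "cfunctional F" and X: "clinear X" and Y: "clinear Y"
    and comm: "\<And>v. X (Y v) = Y (X v)"
    and nil: "\<And>t. nilpotent_op N (\<lambda>v. t *\<^sub>C X v + Y v)"
  shows "((\<lambda>t. F (op_exp (\<lambda>v. t *\<^sub>C X v + Y v) v)) has_field_derivative
           F (op_exp (\<lambda>v. t *\<^sub>C X v + Y v) (X v))) (at t)"
proof -
  define A where "A t = (\<lambda>v. t *\<^sub>C X v + Y v)" for t
  have lin: "clinear (A t ^^ n)" for t n
    using nil by (simp add: A_def nilpotent_op_def clinear_funpow)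
  have lin': "cfunctional (\<lambda>v. F ((A t ^^ n) v))" for t n
    using cfunctional_compose[OF F lin] .
  \<comment> \<open>At n = 0 the truncated n - 1 is harmless, being multiplied by 0. The induction
    step needs the hypothesis at X v and at Y v.\<close>
  have pow: "((\<lambda>t. F ((A t ^^ n) v)) has_field_derivative of_nat n * F ((A t ^^ (n - 1)) (X v))) (at t)"
    for n v
  proof (induction n arbitrary: v)
    case 0
    show ?case by simp
  next
    case (Suc n)
    have "F ((A t ^^ Suc n) v) = t * F ((A t ^^ n) (X v)) + F ((A t ^^ n) (Y v))" for t
      using functional.linear_add[OF lin'] functional.linear_scale[OF lin']
      by (simp add: funpow_swap1) (simp add: A_def)
    moreover have "((\<lambda>t. t * F ((A t ^^ n) (X v)) + F ((A t ^^ n) (Y v))) has_field_derivative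
        F ((A t ^^ n) (X v)) + t * (of_nat n * F ((A t ^^ (n - 1)) (X (X v))))
        + of_nat n * F ((A t ^^ (n - 1)) (X (Y v)))) (at t)"
      by (auto intro!: derivative_eq_intros Suc.IH)
    moreover have "of_nat n * (t * F ((A t ^^ (n - 1)) (X (X v))) + F ((A t ^^ (n - 1)) (X (Y v))))
        = of_nat n * F ((A t ^^ n) (X v))"
    proof (cases n)
      case (Suc m)
      show ?thesis
        unfolding Suc using functional.linear_add[OF lin'] functional.linear_scale[OF lin']
        by (simp add: funpow_swap1 comm) (simp add: A_def)
    qed simp
    ultimately show ?case
      by (simp add: algebra_simps)
  qed
  have nil': "nilpotent_op N (A t)" for t
    using nil by (simp add: A_def)
  have e: "F (op_exp (A t) u) = (\<Sum>n<M. 1 / fact n * F ((A t ^^ n) u))" if "N \<le> M" for t u M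
    by (simp add: op_exp_nilpotent[OF nil' that] functional.linear_sum[OF F]
        functional.linear_scale[OF F])
  \<comment> \<open>With N + 1 terms, losing the constant one and shifting leaves exactly
    \<open>N\<close> terms of the exponential at X v.\<close>
  have "((\<lambda>t. \<Sum>n<Suc N. 1 / fact n * F ((A t ^^ n) v)) has_field_derivative
      (\<Sum>n<Suc N. 1 / fact n * (of_nat n * F ((A t ^^ (n - 1)) (X v))))) (at t)"
    by (intro DERIV_sum DERIV_cmult pow)
  moreover have "(\<Sum>n<Suc N. 1 / fact n * (of_nat n * F ((A t ^^ (n - 1)) (X v)))) =
      F (op_exp (A t) (X v))"
    by (simp add: sum.lessThan_Suc_shift e[OF order_refl] field_simps
        del: sum.lessThan_Suc of_nat_Suc)
  ultimately show ?thesis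
    by (simp add: e[of "Suc N"] flip: A_def del: sum.lessThan_Suc)
qed

text \<open>The iterates \<open>A\<^sup>n v\<close> are eigenvectors of the self-adjoint operator \<open>H\<close> for distinct real
  eigenvalues, hence pairwise orthogonal; a finite-dimensional space has no room for too many.\<close>

lemma ladder_operator_nilpotent:
  fixes H A :: "'v::complex_inner \<Rightarrow> 'v" and B :: "'v set" and a c :: real
  assumes B: "finite B" "complex_vector.span B = UNIV"
    and H: "is_adjoint H H" and A: "clinear A"
    and HA: "\<And>v. H (A v) = A (H v) + complex_of_real c *\<^sub>C A v" and c: "c \<noteq> 0"
    and v: "H v = complex_of_real a *\<^sub>C v"
  shows "(A ^^ card B) v = 0"
proof (rule ccontr)
  assume nz: "(A ^^ card B) v \<noteq> 0"
  define u where "u n = (A ^^ n) v" for n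
  have zero: "(A ^^ n) 0 = 0" for n
    using operator.linear_0[OF clinear_funpow[OF A]] .
  have u_nz: "u n \<noteq> 0" if "n \<le> card B" for n
  proof
    assume "u n = 0"
    then have "(A ^^ (card B - n)) (u n) = 0"
      by (simp add: zero)
    then show False
      using nz that by (simp add: u_def flip: funpow_add comp_apply[of "A ^^ (card B - n)"])
  qed
  have Hu: "H (u n) = complex_of_real (a + n * c) *\<^sub>C u n" for n
  proof (induction n)
    case 0
    show ?case by (simp add: u_def v)
  next
    case (Suc n)
    have "H (u (Suc n)) = complex_of_real (a + n * c) *\<^sub>C u (Suc n) + complex_of_real c *\<^sub>C u (Suc n)"
      using HA[of "u n"] Suc.IH by (simp add: u_def operator.linear_scale[OF A])
    also have "\<dots> = complex_of_real (a + n * c + c) *\<^sub>C u (Suc n)"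
      by (simp only: of_real_add scaleC_add_left)
    finally show ?case
      by (simp add: algebra_simps)
  qed
  have orth: "cinner (u m) (u n) = 0" if "m \<noteq> n" for m n
  proof -
    have "cinner (H (u m)) (u n) = cinner (u m) (H (u n))"
      using H by (simp add: is_adjoint_def)
    then have "complex_of_real (a + m * c) * cinner (u m) (u n) = complex_of_real (a + n * c) * cinner (u m) (u n)"
      unfolding Hu cinner_scaleC_left cinner_scaleC_right by simp
    then show ?thesis
      using that c by simp
  qed
  have u_pos: "cinner (u n) (u n) \<noteq> 0" if "n \<le> card B" for n
    using cinner_pos[OF u_nz[OF that]] by auto
  have inj: "inj_on u {..card B}"
    by (metis atMost_iff inj_onI orth u_pos)
  \<comment> \<open>An iterate in the span of the others would be orthogonal to itself, since the
    vectors orthogonal to \<open>u n\<close> form a subspace.\<close>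
  have "complex_vector.independent (u ` {..card B})"
    unfolding complex_vector.dependent_def
  proof safe
    fix n assume n: "n \<le> card B" and "u n \<in> complex_vector.span (u ` {..card B} - {u n})"
    moreover have "cinner (u n) x = 0" if "x \<in> complex_vector.span (u ` {..card B} - {u n})" for x
      using that
    proof (induction rule: complex_vector.span_induct)
      case base
      show ?case
        by (rule functional.linear_subspace_kernel[OF cfunctional_cinner])
    next
      case (step x)
      then show ?case by (auto intro!: orth)
    qed
    ultimately show False
      using u_pos[OF n] by simp
  qed
  then have "card (u ` {..card B}) \<le> card B"
    using complex_vector.independent_span_bound[OF B(1)] B(2) by simp
  then show False
    by (simp add: card_image[OF inj])
qed

section \<open>Matrix computations in gl(3)\<close>

lemma gl3_nth:
  shows "Cgen i j $ k $ l = (if k = i \<and> l = j then 1 else 0)"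
    and "mscale c X $ k $ l = c * X $ k $ l"
    and "(X ** Y) $ k $ l = (\<Sum>m\<in>UNIV. X $ k $ m * Y $ m $ l)"
    and "conj_transpose X $ k $ l = cnj (X $ l $ k)"
  by (simp_all add: Cgen_def mscale_def matrix_matrix_mult_def conj_transpose_def)

lemmas gl3_simps = vec_eq_iff forall_3 sum_3 gl3_nth lie_def

lemma gl3_mult_simps:
  fixes X Y Z :: gl3
  shows "X ** (Y - Z) = X ** Y - X ** Z" and "(X - Y) ** Z = X ** Z - Y ** Z"
    and "X ** (- Y) = - (X ** Y)" and "(- X) ** Y = - (X ** Y)" and "X ** 0 = 0" and "0 ** X = 0"
  by (simp_all add: matrix_matrix_mult_def vec_eq_iff sum_subtractf sum_negf algebra_simps)

section \<open>Weight vectors and nilpotency in the representation\<close>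

locale u3_irrep =
  fixes \<pi> :: "gl3 \<Rightarrow> 'v::complex_inner \<Rightarrow> 'v" and w :: "real ^ 3" and \<phi> :: 'v and B :: "'v set"
  assumes B: "finite B" "complex_vector.span B = UNIV"
    and rep: "gl3_rep \<pi>"
    and unitary: "unitary_rep \<pi>"
    and irreducible: "irreducible_rep \<pi>"
    and highest_weight: "highest_weight_vector \<pi> w \<phi>"
begin

lemma clinear_rep: "clinear (\<pi> X)"
  and rep_add: "\<pi> (X + Y) v = \<pi> X v + \<pi> Y v"
  and rep_mscale: "\<pi> (mscale c X) v = c *\<^sub>C \<pi> X v"
  and rep_lie: "\<pi> (lie X Y) v = \<pi> X (\<pi> Y v) - \<pi> Y (\<pi> X v)"
  using rep unfolding gl3_rep_def by blast+

lemma rep_0: "\<pi> 0 v = 0"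
  using rep_add[of 0 0 v] by simp

lemma rep_comm: "\<pi> X (\<pi> Y v) = \<pi> Y (\<pi> X v) + \<pi> (lie X Y) v"
  by (simp add: rep_lie)

lemma rep_expand: "\<pi> X v = (\<Sum>i\<in>UNIV. \<Sum>j\<in>UNIV. (X $ i $ j) *\<^sub>C \<pi> (Cgen i j) v)"
proof -
  have "X = (\<Sum>i\<in>UNIV. \<Sum>j\<in>UNIV. mscale (X $ i $ j) (Cgen i j))"
    by (simp add: gl3_simps)
  then have "\<pi> X v = \<pi> (\<Sum>i\<in>UNIV. \<Sum>j\<in>UNIV. mscale (X $ i $ j) (Cgen i j)) v"
    by simp
  then show ?thesis
    by (simp add: sum_3 rep_add rep_mscale)
qed

lemma functional_rep_expand:
  assumes "cfunctional F"
  shows "F (\<pi> X v) = (\<Sum>i\<in>UNIV. \<Sum>j\<in>UNIV. X $ i $ j * F (\<pi> (Cgen i j) v))"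
  by (subst rep_expand) (simp add: functional.linear_sum[OF assms] functional.linear_scale[OF assms])

lemma is_adjoint_rep: "is_adjoint (\<pi> X) (\<pi> (conj_transpose X))"
  unfolding is_adjoint_def
proof (intro allI)
  fix x y
  have "cinner (\<pi> (Cgen i j) x) y = cinner x (\<pi> (Cgen j i) y)" for i j
    using unitary_rep_Cgen[OF rep unitary, of j i] by (simp add: is_adjoint_def)
  then have "cinner (\<pi> (conj_transpose X) x) y
      = (\<Sum>i\<in>UNIV. \<Sum>j\<in>UNIV. X $ j $ i * cinner x (\<pi> (Cgen j i) y))"
    by (subst rep_expand) (simp add: cinner_sum_left cinner_scaleC_left conj_transpose_def)
  also have "\<dots> = cinner x (\<pi> X y)"
    by (subst sum.swap) (rule functional_rep_expand[OF cfunctional_cinner, symmetric])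
  finally show "cinner (\<pi> (conj_transpose X) x) y = cinner x (\<pi> X y)" .
qed

definition weight_vectors :: "'v set"
  where "weight_vectors = {v. \<forall>i. \<exists>a::real. \<pi> (Cgen i i) v = complex_of_real a *\<^sub>C v}"

lemma rep_Cgen_weight_vectors:
  assumes "v \<in> weight_vectors"
  shows "\<pi> (Cgen i j) v \<in> weight_vectors"
  unfolding weight_vectors_def
proof (intro CollectI allI)
  fix k
  obtain a :: real where a: "\<pi> (Cgen k k) v = complex_of_real a *\<^sub>C v"
    using assms by (auto simp: weight_vectors_def)
  have "lie (Cgen k k) (Cgen i j) = mscale (of_bool (k = i) - of_bool (j = k)) (Cgen i j)"
    by (auto simp: lie_Cgen vec_eq_iff mscale_def)
  then have "\<pi> (Cgen k k) (\<pi> (Cgen i j) v)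
      = complex_of_real a *\<^sub>C \<pi> (Cgen i j) v + (of_bool (k = i) - of_bool (j = k)) *\<^sub>C \<pi> (Cgen i j) v"
    by (simp add: rep_comm[of "Cgen k k"] rep_mscale a operator.linear_scale[OF clinear_rep])
  also have "\<dots> = complex_of_real (a + (of_bool (k = i) - of_bool (j = k))) *\<^sub>C \<pi> (Cgen i j) v"
    by (simp flip: scaleC_add_left)
  finally show "\<exists>a::real. \<pi> (Cgen k k) (\<pi> (Cgen i j) v) = complex_of_real a *\<^sub>C \<pi> (Cgen i j) v"
    by blast
qed

lemma span_weight_vectors: "complex_vector.span weight_vectors = UNIV"
proof -
  have "\<pi> X v \<in> complex_vector.span weight_vectors"
    if "v \<in> complex_vector.span weight_vectors" for X v
    using that
  proof (induction rule: complex_vector.span_induct)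
    case base
    show ?case
      using operator.linear_subspace_vimage[OF clinear_rep complex_vector.subspace_span]
      by (simp add: vimage_def)
  next
    case (step v)
    show ?case
      by (subst rep_expand)
         (intro complex_vector.span_sum complex_vector.span_scale complex_vector.span_base
           rep_Cgen_weight_vectors step)
  qed
  then have "complex_vector.span weight_vectors = {0} \<or> complex_vector.span weight_vectors = UNIV"
    using irreducible complex_vector.subspace_span unfolding irreducible_rep_def by blast
  moreover have "\<phi> \<in> weight_vectors" "\<phi> \<noteq> 0"
    using highest_weight by (auto simp: highest_weight_vector_def weight_vectors_def)
  ultimately show ?thesis
    using complex_vector.span_base by blast
qed

text \<open>The relation makes A a ladder operator for the self-adjoint image of C_ii, so the power
  \<open>card B\<close> kills every weight vector. Its kernel is a subspace, hence
  everything.\<close>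

lemma nilpotent_rep:
  fixes c :: real
  assumes "lie (Cgen i i) A = mscale (complex_of_real c) A" and "c \<noteq> 0"
  shows "nilpotent_op (card B) (\<pi> A)"
proof -
  have "v \<in> complex_vector.span weight_vectors \<Longrightarrow> (\<pi> A ^^ card B) v = 0" for v
  proof (induction rule: complex_vector.span_induct)
    case base
    show ?case
      by (rule operator.linear_subspace_kernel[OF clinear_funpow[OF clinear_rep]])
  next
    case (step v)
    then obtain a :: real where "\<pi> (Cgen i i) v = complex_of_real a *\<^sub>C v"
      by (auto simp: weight_vectors_def)
    moreover have "is_adjoint (\<pi> (Cgen i i)) (\<pi> (Cgen i i))"
      using is_adjoint_rep[of "Cgen i i"] by (simp add: conj_transpose_Cgen)
    moreover have "\<pi> (Cgen i i) (\<pi> A u) = \<pi> A (\<pi> (Cgen i i) u) + complex_of_real c *\<^sub>C \<pi> A u" for u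
      by (simp add: rep_comm[of "Cgen i i"] rep_mscale assms(1))
    ultimately show ?case
      by (intro ladder_operator_nilpotent[OF B _ clinear_rep _ assms(2)])
  qed
  then show ?thesis
    by (simp add: nilpotent_op_def clinear_rep span_weight_vectors)
qed

text \<open>This lifts (1 + A) X (1 - A) = X + [A, X] - A X A to the representation, which is
  assumed to respect commutators, not products. From A^2 = 0 follow [A, [A, X]] = -2 A X A and
  [A, A X A] = 0.\<close>

lemma op_exp_rep:
  assumes nil: "nilpotent_op N (\<pi> A)" and sq: "A ** A = 0"
  shows "op_exp (\<pi> A) (\<pi> X v) = \<pi> (X + lie A X - A ** X ** A) (op_exp (\<pi> A) v)"
proof -
  let ?Z = "- (A ** X ** A)"
  have "lie A (lie A X) = mscale 2 ?Z"
  proof -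
    have "lie A (lie A X) = A ** A ** X - A ** X ** A - (A ** X ** A - X ** (A ** A))"
      by (simp add: lie_def gl3_mult_simps matrix_mul_assoc)
    also have "\<dots> = - (A ** X ** A) - A ** X ** A"
      by (simp add: sq gl3_mult_simps)
    finally show ?thesis
      by (simp add: vec_eq_iff mscale_def)
  qed
  moreover have "lie A ?Z = 0"
  proof -
    have "lie A ?Z = A ** X ** (A ** A) - A ** A ** X ** A"
      by (simp add: lie_def gl3_mult_simps matrix_mul_assoc)
    then show ?thesis
      by (simp add: sq gl3_mult_simps)
  qed
  ultimately have "op_exp (\<pi> A) (\<pi> X v) = \<pi> X (op_exp (\<pi> A) v)
      + \<pi> (lie A X) (op_exp (\<pi> A) v) + \<pi> ?Z (op_exp (\<pi> A) v)"
    by (intro op_exp_intertwine[OF nil] clinear_rep)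
       (simp_all add: rep_comm[of A] rep_mscale rep_0)
  then show ?thesis
    by (simp flip: rep_add)
qed

section \<open>Coherent state functions with a generator inserted\<close>

definition A12 :: "complex \<Rightarrow> complex \<Rightarrow> gl3"
  where "A12 z12 z13 = mscale z12 (Cgen 1 2) + mscale z13 (Cgen 1 3)"

definition A23 :: "complex \<Rightarrow> gl3"
  where "A23 z23 = mscale z23 (Cgen 2 3)"

text \<open>Bracketing with C_11 fixes C_12 and C_13 alike, hence all their combinations; the
  conjugate transposes get the factor -1. For C_23 the generator C_22 does the same.\<close>

lemma nilpotent_A12: "nilpotent_op (card B) (\<pi> (A12 z12 z13))"
  and nilpotent_A12': "nilpotent_op (card B) (\<pi> (conj_transpose (A12 z12 z13)))"
  and nilpotent_A23: "nilpotent_op (card B) (\<pi> (A23 z23))"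
  and nilpotent_A23': "nilpotent_op (card B) (\<pi> (conj_transpose (A23 z23)))"
  by (rule nilpotent_rep[of 1 _ 1] nilpotent_rep[of 1 _ "- 1"]
      nilpotent_rep[of 2 _ 1] nilpotent_rep[of 2 _ "- 1"]; simp add: A12_def A23_def gl3_simps; fail)+

lemma square_A12: "A12 z12 z13 ** A12 z12 z13 = 0" and square_A23: "A23 z23 ** A23 z23 = 0"
  by (simp_all add: A12_def A23_def gl3_simps)

text \<open>\<open>cadjoint\<close> is a choice, so an adjoint of \<open>Vplus\<close> is exhibited:
  the exponentials of the conjugate transposes in reverse order.\<close>

lemma coh_fun_eq:
  "coh_fun \<pi> \<phi> \<psi> (z12, z13, z23)
    = cinner \<phi> (op_exp (\<pi> (A23 z23)) (op_exp (\<pi> (A12 z12 z13)) \<psi>))"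
proof -
  let ?V = "\<lambda>v. op_exp (\<pi> (conj_transpose (A12 z12 z13))) (op_exp (\<pi> (conj_transpose (A23 z23))) v)"
  have V: "Vplus \<pi> (z12, z13, z23) = op_exp (\<pi> (A23 z23)) \<circ> op_exp (\<pi> (A12 z12 z13))"
    by (simp add: Vplus_def A12_def A23_def rep_add[abs_def] rep_mscale[abs_def])
  have "is_adjoint (Vplus \<pi> (z12, z13, z23)) ?V"
    using is_adjoint_op_exp[OF nilpotent_A12 nilpotent_A12' is_adjoint_rep]
      is_adjoint_op_exp[OF nilpotent_A23 nilpotent_A23' is_adjoint_rep]
    by (simp add: is_adjoint_def V)
  then show ?thesis
    by (simp add: coh_fun_def coherent_def cadjoint_eq) (simp add: is_adjoint_def V)
qed

text \<open>Derivatives are recognised with X between the exponentials, the highest weight with X in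
  front of both (\<open>coh_fun_left\<close>).\<close>

definition coh_fun_mid :: "'v \<Rightarrow> coords \<Rightarrow> gl3 \<Rightarrow> complex"
  where "coh_fun_mid \<psi> = (\<lambda>(z12, z13, z23) X.
    cinner \<phi> (op_exp (\<pi> (A23 z23)) (\<pi> X (op_exp (\<pi> (A12 z12 z13)) \<psi>))))"

definition coh_fun_left :: "'v \<Rightarrow> coords \<Rightarrow> gl3 \<Rightarrow> complex"
  where "coh_fun_left \<psi> = (\<lambda>(z12, z13, z23) X.
    cinner \<phi> (\<pi> X (op_exp (\<pi> (A23 z23)) (op_exp (\<pi> (A12 z12 z13)) \<psi>))))"

lemma cfunctional_op_exp_A23: "cfunctional (\<lambda>v. cinner \<phi> (op_exp (\<pi> (A23 z23)) v))"
  by (intro cfunctional_compose[OF cfunctional_cinner] clinear_op_exp[OF nilpotent_A23])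

lemma coh_fun_rep:
  "coh_fun \<pi> \<phi> (\<pi> X \<psi>) (z12, z13, z23) =
    (\<Sum>i\<in>UNIV. \<Sum>j\<in>UNIV. (X + lie (A12 z12 z13) X - A12 z12 z13 ** X ** A12 z12 z13) $ i $ j
      * coh_fun_mid \<psi> (z12, z13, z23) (Cgen i j))"
  unfolding coh_fun_eq op_exp_rep[OF nilpotent_A12 square_A12] coh_fun_mid_def prod.case
  by (rule functional_rep_expand[OF cfunctional_op_exp_A23])

lemma coh_fun_mid_eq:
  "coh_fun_mid \<psi> (z12, z13, z23) X =
    (\<Sum>i\<in>UNIV. \<Sum>j\<in>UNIV. (X + lie (A23 z23) X - A23 z23 ** X ** A23 z23) $ i $ j
      * coh_fun_left \<psi> (z12, z13, z23) (Cgen i j))"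
  unfolding coh_fun_mid_def coh_fun_left_def prod.case op_exp_rep[OF nilpotent_A23 square_A23]
  by (rule functional_rep_expand[OF cfunctional_cinner])

text \<open>Moved onto \<open>\<phi>\<close>, a lowering generator becomes a raising one and kills
  it; a diagonal one yields its weight, which is real and so survives conjugation.\<close>

lemma coh_fun_left_Cgen:
  "coh_fun_left \<psi> z (Cgen 2 1) = 0" "coh_fun_left \<psi> z (Cgen 3 1) = 0" "coh_fun_left \<psi> z (Cgen 3 2) = 0"
  "coh_fun_left \<psi> z (Cgen i i) = w $ i * coh_fun \<pi> \<phi> \<psi> z"
proof -
  have move: "cinner \<phi> (\<pi> (Cgen i j) v) = cinner (\<pi> (Cgen j i) \<phi>) v" for i j v
    using unitary_rep_Cgen[OF rep unitary, of i j] by (simp add: is_adjoint_def)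
  have zero: "cinner 0 v = 0" for v :: 'v
    using cinner_sum_left[of _ "{}" v] by simp
  show "coh_fun_left \<psi> z (Cgen 2 1) = 0" "coh_fun_left \<psi> z (Cgen 3 1) = 0" "coh_fun_left \<psi> z (Cgen 3 2) = 0"
    "coh_fun_left \<psi> z (Cgen i i) = w $ i * coh_fun \<pi> \<phi> \<psi> z"
    using highest_weight
    by (cases z; simp add: coh_fun_left_def coh_fun_eq move zero cinner_scaleC_left highest_weight_vector_def)+
qed

lemma rep_commute: "lie X Y = 0 \<Longrightarrow> \<pi> X (\<pi> Y v) = \<pi> Y (\<pi> X v)"
  by (simp add: rep_comm[of X] rep_0)

lemma op_exp_commute:
  assumes "nilpotent_op N (\<pi> A)" "A ** A = 0" "lie A X = 0" "A ** X ** A = 0"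
  shows "op_exp (\<pi> A) (\<pi> X v) = \<pi> X (op_exp (\<pi> A) v)"
  using op_exp_rep[OF assms(1,2), of X v] assms(3,4) by simp

text \<open>Each derivative inserts its generator. For z12 and z13 it appears at \<psi> and passes
  the exponential of \<open>A12 z12 z13\<close>, which commutes with C_12 and C_13.\<close>

lemma d12_coh_fun: "d12 (coh_fun \<pi> \<phi> \<psi>) z = coh_fun_mid \<psi> z (Cgen 1 2)"
  and d13_coh_fun: "d13 (coh_fun \<pi> \<phi> \<psi>) z = coh_fun_mid \<psi> z (Cgen 1 3)"
  and d23_coh_fun: "d23 (coh_fun \<pi> \<phi> \<psi>) z = coh_fun_mid \<psi> z (Cgen 2 3)"
proof -
  obtain z12 z13 z23 where z: "z = (z12, z13, z23)"
    by (cases z)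
  have deriv_exp: "deriv (\<lambda>t. F (op_exp (\<pi> (mscale t X + Y)) v)) t = F (op_exp (\<pi> (mscale t X + Y)) (\<pi> X v))"
    if "cfunctional F" "lie X Y = 0" "\<And>t. nilpotent_op (card B) (\<pi> (mscale t X + Y))" for F X Y v t
    using has_field_derivative_op_exp[OF that(1) clinear_rep clinear_rep rep_commute[OF that(2)], of "card B" v t] that(3)
    by (intro DERIV_imp_deriv) (simp add: rep_add[abs_def] rep_mscale[abs_def])
  have "deriv (\<lambda>t. coh_fun \<pi> \<phi> \<psi> (t, z13, z23)) z12
      = cinner \<phi> (op_exp (\<pi> (A23 z23)) (op_exp (\<pi> (A12 z12 z13)) (\<pi> (Cgen 1 2) \<psi>)))"
    using deriv_exp[OF cfunctional_op_exp_A23, of "Cgen 1 2" "mscale z13 (Cgen 1 3)" z23 \<psi> z12] nilpotent_A12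
    by (simp add: coh_fun_eq A12_def gl3_simps)
  then show "d12 (coh_fun \<pi> \<phi> \<psi>) z = coh_fun_mid \<psi> z (Cgen 1 2)"
    by (subst (asm) op_exp_commute[OF nilpotent_A12 square_A12])
       (simp_all add: d12_def coh_fun_mid_def z, simp_all add: A12_def gl3_simps)
  have A12': "A12 z12 t = mscale t (Cgen 1 3) + mscale z12 (Cgen 1 2)" for t
    by (simp add: A12_def add.commute)
  have "deriv (\<lambda>t. coh_fun \<pi> \<phi> \<psi> (z12, t, z23)) z13
      = cinner \<phi> (op_exp (\<pi> (A23 z23)) (op_exp (\<pi> (A12 z12 z13)) (\<pi> (Cgen 1 3) \<psi>)))"
    using deriv_exp[OF cfunctional_op_exp_A23, of "Cgen 1 3" "mscale z12 (Cgen 1 2)" z23 \<psi> z13]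
      nilpotent_A12[of z12]
    by (simp add: coh_fun_eq A12' gl3_simps)
  then show "d13 (coh_fun \<pi> \<phi> \<psi>) z = coh_fun_mid \<psi> z (Cgen 1 3)"
    by (subst (asm) op_exp_commute[OF nilpotent_A12 square_A12])
       (simp_all add: d13_def coh_fun_mid_def z, simp_all add: A12_def gl3_simps)
  \<comment> \<open>Only the left exponential depends on z23, so the other one belongs to the fixed
    vector and Y = 0.\<close>
  have "deriv (\<lambda>t. coh_fun \<pi> \<phi> \<psi> (z12, z13, t)) z23
      = cinner \<phi> (op_exp (\<pi> (A23 z23)) (\<pi> (Cgen 2 3) (op_exp (\<pi> (A12 z12 z13)) \<psi>)))"
    using deriv_exp[OF cfunctional_cinner, of "Cgen 2 3" 0 _ "op_exp (\<pi> (A12 z12 z13)) \<psi>" z23] nilpotent_A23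
    by (simp add: coh_fun_eq A23_def lie_def)
  then show "d23 (coh_fun \<pi> \<phi> \<psi>) z = coh_fun_mid \<psi> z (Cgen 2 3)"
    by (simp add: d23_def coh_fun_mid_def z)
qed

text \<open>Past the exponential of \<open>A23 z23\<close>, lowering and diagonal generators leave
  only weights, vanishing lowering terms and multiples of C_23. The latter give \<open>d23\<close>,
  since C_23 commutes with \<open>A23 z23\<close>.\<close>

lemma coh_fun_mid_Cgen:
  fixes \<psi> :: 'v and z12 z13 z23 :: complex and f :: "coords \<Rightarrow> complex"
  defines "z \<equiv> (z12, z13, z23)"
  defines "f \<equiv> coh_fun \<pi> \<phi> \<psi>"
  shows "coh_fun_mid \<psi> z (Cgen 1 2) = d12 f z"
    and "coh_fun_mid \<psi> z (Cgen 1 3) = d13 f z"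
    and "coh_fun_mid \<psi> z (Cgen 2 3) = d23 f z"
    and "coh_fun_mid \<psi> z (Cgen 2 1) = 0"
    and "coh_fun_mid \<psi> z (Cgen 3 1) = 0"
    and "coh_fun_mid \<psi> z (Cgen 3 2) = (w $ 2 - w $ 3) * z23 * f z - z23\<^sup>2 * d23 f z"
    and "coh_fun_mid \<psi> z (Cgen 1 1) = w $ 1 * f z"
    and "coh_fun_mid \<psi> z (Cgen 2 2) = w $ 2 * f z - z23 * d23 f z"
    and "coh_fun_mid \<psi> z (Cgen 3 3) = w $ 3 * f z + z23 * d23 f z"
  unfolding z_def f_def d12_coh_fun d13_coh_fun d23_coh_fun
  by (simp_all add: coh_fun_mid_eq coh_fun_left_Cgen A23_def gl3_simps algebra_simps power2_eq_square)

end

section \<open>The nine differential operators\<close>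

theorem lemma4:
  fixes \<pi> :: "gl3 \<Rightarrow> 'v::complex_inner \<Rightarrow> 'v"
    and w :: "real ^ 3"
    and \<phi> :: 'v
  assumes "cfinite_dim TYPE('v)"
    and "gl3_rep \<pi>"
    and "unitary_rep \<pi>"
    and "irreducible_rep \<pi>"
    and "highest_weight_vector \<pi> w \<phi>"
    and "w $ 1 - w $ 2 \<ge> 0"
    and "w $ 2 - w $ 3 \<ge> 0"
  shows
    "associated_op \<pi> \<phi> (Cgen 1 1) (\<lambda>f (z12, z13, z23).
           - z12 * d12 f (z12, z13, z23) - z13 * d13 f (z12, z13, z23) + w $ 1 * f (z12, z13, z23)) \<and>
     associated_op \<pi> \<phi> (Cgen 1 2) (\<lambda>f (z12, z13, z23). d12 f (z12, z13, z23)) \<and>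
     associated_op \<pi> \<phi> (Cgen 1 3) (\<lambda>f (z12, z13, z23). d13 f (z12, z13, z23)) \<and>
     associated_op \<pi> \<phi> (Cgen 2 1) (\<lambda>f (z12, z13, z23).
           - z12\<^sup>2 * d12 f (z12, z13, z23) - z12 * z13 * d13 f (z12, z13, z23)
           + (z12 * z23 - z13) * d23 f (z12, z13, z23)
           + (w $ 1 - w $ 2) * z12 * f (z12, z13, z23)) \<and>
     associated_op \<pi> \<phi> (Cgen 2 2) (\<lambda>f (z12, z13, z23).
           z12 * d12 f (z12, z13, z23) - z23 * d23 f (z12, z13, z23) + w $ 2 * f (z12, z13, z23)) \<and>
     associated_op \<pi> \<phi> (Cgen 2 3) (\<lambda>f (z12, z13, z23).
           z12 * d13 f (z12, z13, z23) + d23 f (z12, z13, z23)) \<and>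
     associated_op \<pi> \<phi> (Cgen 3 1) (\<lambda>f (z12, z13, z23).
           - z12 * z13 * d12 f (z12, z13, z23) - z13\<^sup>2 * d13 f (z12, z13, z23)
           + (z12 * z23 - z13) * z23 * d23 f (z12, z13, z23)
           + ((w $ 1 - w $ 3) * z13 - (w $ 2 - w $ 3) * z12 * z23) * f (z12, z13, z23)) \<and>
     associated_op \<pi> \<phi> (Cgen 3 2) (\<lambda>f (z12, z13, z23).
           z13 * d12 f (z12, z13, z23) - z23\<^sup>2 * d23 f (z12, z13, z23)
           + (w $ 2 - w $ 3) * z23 * f (z12, z13, z23)) \<and>
     associated_op \<pi> \<phi> (Cgen 3 3) (\<lambda>f (z12, z13, z23).
           z13 * d13 f (z12, z13, z23) + z23 * d23 f (z12, z13, z23) + w $ 3 * f (z12, z13, z23))"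
proof -
  obtain B :: "'v set" where "finite B" "complex_vector.span B = UNIV"
    using assms(1) by (auto simp: cfinite_dim_def)
  then interpret u3_irrep \<pi> w \<phi> B
    using assms by unfold_locales
  show ?thesis
    \<comment> \<open>The first simplification inserts the nine middle values, the second evaluates
      their coefficients. For instance, C_21 turns into C_21 + z12 (C_11 - C_22) - z13 C_23 - z12^2
      C_12 - z12 z13 C_13.\<close>
    unfolding associated_op_def fun_eq_iff split_paired_All prod.case coh_fun_rep
    by (simp add: sum_3 coh_fun_mid_Cgen)
       (simp add: A12_def gl3_simps algebra_simps power2_eq_square)
qed

end
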